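(* Let $N(t):=\sum_{n\geq1}N_nt^n$, a formal power series in $t$ with coefficients in polynomials in $u_1,u_2,u_3,v_1,v_2$. Then $$N(t)=\frac{at^2-ct+1}{2t}-\frac{\sqrt{a^2t^4+2(bc-2u_1-2u_2v_2)t^3+(c^2-2b)t^2-2ct+1}}{2t},$$ where $a=u_1-u_3+v_1-v_2$, $b=u_1+u_3-v_1+v_2$ and $c=v_1+1$ (and the square root is the formal power series with constant term $1$).
   Context: A plane tree is a rooted tree in which the children of each node are linearly ordered (from left to right); $\mathcal{P}_n$ is the set of plane trees with $n$ edges. A leaf is a node without children. The "second child" of a node is its second child from the left. A leaf is an old leaf if it is the leftmost child of its parent, and a young leaf otherwise. An old leaf is a singleton leaf if it is the only child of its parent, and an elder leaf if it has siblings. For a plane tree $T$: $\mathsf{sleaf}(T)$ is the number of singleton leaves; $\mathsf{etleaf}(T)$ (resp. $\mathsf{entleaf}(T)$) is the number of elder leaves such that the second child of their parent is a leaf (resp. is not a leaf); $\mathsf{syleaf}(T)$ (resp. $\mathsf{yerleaf}(T)$) is the number of young leaves that are (resp. are not) the second child of their parent. Define $$N_n=N_n(u_1,u_2,u_3;v_1,v_2):=\sum_{T\in\mathcal{P}_n}u_1^{\mathsf{sleaf}(T)} u_2^{\mathsf{etleaf}(T)} u_3^{\mathsf{entleaf}(T)} v_1^{\mathsf{yerleaf}(T)} v_2^{\mathsf{syleaf}(T)}$$ for $n\geq2$, and $N_1:=u_1$. *)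

theory Defs
  imports
    "HOL-Computational_Algebra.Computational_Algebra"
    "HOL-Library.Poly_Mapping"
begin

datatype plane_tree = Node (children: "plane_tree list")

text \<open>
  A node is identified with its address, the list of (0-based) child indices on the path from
  the root; the root is \<open>[]\<close>, and the parent of \<open>p @ [i]\<close> is \<open>p\<close>.
\<close>

primrec is_node :: "plane_tree \<Rightarrow> nat list \<Rightarrow> bool" where
  "is_node T [] = True"
| "is_node T (i # p) = (i < length (children T) \<and> is_node (children T ! i) p)"

definition nodes :: "plane_tree \<Rightarrow> nat list set" where
  "nodes T = {p. is_node T p}"

definition tree_edges :: "plane_tree \<Rightarrow> (nat list \<times> nat list) set" where
  "tree_edges T = {(p, q). q \<in> nodes T \<and> (\<exists>i. q = p @ [i])}"

definition plane_trees :: "nat \<Rightarrow> plane_tree set" where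
  "plane_trees n = {T. card (tree_edges T) = n}"

definition children_of :: "plane_tree \<Rightarrow> nat list \<Rightarrow> nat list set" where
  "children_of T p = {q \<in> nodes T. \<exists>i. q = p @ [i]}"

definition leaves :: "plane_tree \<Rightarrow> nat list set" where
  "leaves T = {p \<in> nodes T. children_of T p = {}}"

definition old_leaves :: "plane_tree \<Rightarrow> nat list set" where
  "old_leaves T = {p \<in> leaves T. \<exists>q. p = q @ [0]}"

text \<open>
  The root of the one-node tree has no parent and falls under ``otherwise'' here; that tree
  has no edges and never enters \<open>N_coeff n\<close> for \<open>n \<ge> 1\<close>.
\<close>

definition young_leaves :: "plane_tree \<Rightarrow> nat list set" where
  "young_leaves T = leaves T - old_leaves T"

definition singleton_leaves :: "plane_tree \<Rightarrow> nat list set" where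
  "singleton_leaves T = {p \<in> old_leaves T. children_of T (butlast p) = {p}}"

definition elder_leaves :: "plane_tree \<Rightarrow> nat list set" where
  "elder_leaves T = {p \<in> old_leaves T. children_of T (butlast p) \<noteq> {p}}"

definition sleaf :: "plane_tree \<Rightarrow> nat" where
  "sleaf T = card (singleton_leaves T)"

definition etleaf :: "plane_tree \<Rightarrow> nat" where
  "etleaf T = card {p \<in> elder_leaves T. butlast p @ [1] \<in> leaves T}"

definition entleaf :: "plane_tree \<Rightarrow> nat" where
  "entleaf T = card {p \<in> elder_leaves T. butlast p @ [1] \<notin> leaves T}"

definition syleaf :: "plane_tree \<Rightarrow> nat" where
  "syleaf T = card {p \<in> young_leaves T. \<exists>q. p = q @ [1]}"

definition yerleaf :: "plane_tree \<Rightarrow> nat" where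
  "yerleaf T = card {p \<in> young_leaves T. \<not> (\<exists>q. p = q @ [1])}"

definition N_coeff :: "nat \<Rightarrow> 'a \<Rightarrow> 'a \<Rightarrow> 'a \<Rightarrow> 'a \<Rightarrow> 'a \<Rightarrow> 'a :: comm_semiring_1" where
  "N_coeff n u1 u2 u3 v1 v2 =
     (if n = 1 then u1
      else \<Sum>T\<in>plane_trees n. u1 ^ sleaf T * u2 ^ etleaf T * u3 ^ entleaf T
                             * v1 ^ yerleaf T * v2 ^ syleaf T)"

definition N_series :: "'a \<Rightarrow> 'a \<Rightarrow> 'a \<Rightarrow> 'a \<Rightarrow> 'a \<Rightarrow> 'a :: comm_semiring_1 fps" where
  "N_series u1 u2 u3 v1 v2 = Abs_fps (\<lambda>n. if n = 0 then 0 else N_coeff n u1 u2 u3 v1 v2)"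

text \<open>
  Multivariate polynomials over the rationals: finitely supported maps from monomials
  (exponent vectors) to coefficients, multiplied by convolution.
\<close>

type_synonym mpoly = "(nat \<Rightarrow>\<^sub>0 nat) \<Rightarrow>\<^sub>0 rat"

definition indet :: "nat \<Rightarrow> mpoly" where
  "indet i = Poly_Mapping.single (Poly_Mapping.single i 1) 1"

definition fps_sqrt :: "'a :: comm_ring_1 fps \<Rightarrow> 'a fps" where
  "fps_sqrt f = (THE g. fps_nth g 0 = 1 \<and> g ^ 2 = f)"

text \<open>
  The quotients by \<open>2 * t\<close> are not power series individually, so they are taken in the field of
  formal Laurent series over the fraction field of the polynomial ring.
\<close>

definition to_laurent :: "'a :: idom fps \<Rightarrow> 'a fract fls" where
  "to_laurent f = fps_to_fls (Abs_fps (\<lambda>n. to_fract (fps_nth f n)))"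

text \<open>The description in \<open>fps_sqrt\<close> is proper for polynomial coefficients.\<close>

fun sqrt_coeff :: "mpoly fps \<Rightarrow> nat \<Rightarrow> mpoly" where
  "sqrt_coeff f n = (if n = 0 then 1
     else Poly_Mapping.single 0 (1/2) *
          (fps_nth f n - (\<Sum>i\<in>{1..<n}. if i < n \<and> 0 < i then sqrt_coeff f i * sqrt_coeff f (n - i) else 0)))"

declare sqrt_coeff.simps [simp del]

lemma fps_sqrt_ex1:
  fixes f :: "mpoly fps"
  assumes "fps_nth f 0 = 1"
  shows "\<exists>!g. fps_nth g 0 = 1 \<and> g ^ 2 = f"
proof (rule ex_ex1I)
  define g where "g = Abs_fps (sqrt_coeff f)"
  have half: "2 * (Poly_Mapping.single 0 (1/2) * x) = x" for x :: mpoly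
  proof -
    have "(2::mpoly) * Poly_Mapping.single 0 (1/2) = 1"
      by (simp add: mult_2 flip: single_add)
    then show ?thesis by (metis mult.assoc mult_1)
  qed
  have "fps_nth (g ^ 2) n = fps_nth f n" for n
  proof (cases n)
    case 0
    then show ?thesis using assms
      by (simp add: g_def power2_eq_square sqrt_coeff.simps[of f 0])
  next
    case (Suc m)
    define s where "s = (\<Sum>i\<in>{1..<n}. sqrt_coeff f i * sqrt_coeff f (n - i))"
    have "sqrt_coeff f n = Poly_Mapping.single 0 (1/2) * (fps_nth f n - s)"
      unfolding s_def using Suc by (subst sqrt_coeff.simps) (auto intro!: arg_cong2[of _ _ _ _ "(*)"] sum.cong)
    moreover have "fps_nth (g ^ 2) n = 2 * sqrt_coeff f n + s"
    proof -
      have "{0..n} = insert 0 (insert n {1..<n})" using Suc by auto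
      then show ?thesis using Suc
        by (simp add: g_def power2_eq_square fps_mult_nth s_def sqrt_coeff.simps[of f 0])
    qed
    ultimately show ?thesis by (simp add: half)
  qed
  then show "\<exists>g. fps_nth g 0 = 1 \<and> g ^ 2 = f"
    by (intro exI[of _ g]) (auto simp: g_def fps_eq_iff sqrt_coeff.simps[of f 0])
next
  fix g h assume g: "fps_nth g 0 = 1 \<and> g ^ 2 = f" and h: "fps_nth h 0 = 1 \<and> h ^ 2 = f"
  then have "(g - h) * (g + h) = 0" by (simp add: algebra_simps power2_eq_square)
  moreover have "fps_nth (g + h) 0 \<noteq> 0" using g h by simp
  then have "g + h \<noteq> 0" by force
  ultimately show "g = h" by simp
qed

end

theory Submission
  imports Defs
begin

text \<open>
  Deleting the root splits a plane tree into the list of subtrees at its children, and all five leaf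
  statistics are compatible with this: whether a leaf is counted, and by which statistic,
  depends only on the list of siblings it belongs to and on its position in that list. So each
  statistic is a contribution of the sibling list at the root plus the sum over the subtrees
  (\<open>local_count_Node\<close>), and the weight of a tree is a product of a factor for the root
  and the weights of the subtrees (\<open>weight_single\<close>, \<open>weight_two\<close>).

  Let \<open>S\<close> be the generating function of the lists of children in third or later position.
  Such a child is either a leaf, of weight \<open>v1\<close>, or a tree counted by \<open>N\<close>, so
  \<open>S = 1 / (1 - t * (v1 + N))\<close> (\<open>forest_equation\<close>). A root with one child contributes
  \<open>t * (u1 + N)\<close>. A root with at least two children contributes \<open>t ^ 2 * S\<close> times the
  weight of the first two, which is \<open>u2 * v2\<close> if both are leaves, \<open>u3 * N\<close> or
  \<open>v2 * N\<close> if exactly the first or exactly the second is a leaf, and \<open>N ^ 2\<close> otherwise.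
  Hence (\<open>tree_equation\<close>)
  \<open>N = t * (u1 + N) + t ^ 2 * (u2 * v2 + u3 * N + v2 * N + N ^ 2) * S\<close>.
  After multiplication by \<open>1 - t * (v1 + N)\<close>, the terms \<open>t ^ 2 * N ^ 2\<close> on both sides
  cancel, which leaves, with \<open>P = a * t ^ 2 - c * t + 1\<close>, the quadratic equation
  \<open>t * N ^ 2 - P * N + t * u1 - t ^ 2 * (u1 * v1 - u2 * v2) = 0\<close>.

  The radicand of the theorem is the discriminant of this equation, so it is the square of
  \<open>P - 2 * t * N\<close>. This series has constant term 1, hence it is the square root, and
  solving for \<open>N\<close> gives the formula. Choosing the sign of the root is thus settled by the
  constant term.
\<close>

section \<open>Statistics that are sums of local contributions\<close>

primrec subtree :: "plane_tree \<Rightarrow> nat list \<Rightarrow> plane_tree" where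
  "subtree T [] = T"
| "subtree T (i # p) = subtree (children T ! i) p"

lemma is_node_snoc:
  "is_node T (p @ [i]) \<longleftrightarrow> is_node T p \<and> i < length (children (subtree T p))"
  by (induction p arbitrary: T) auto

lemma subtree_snoc: "subtree T (p @ [i]) = children (subtree T p) ! i"
  by (induction p arbitrary: T) auto

lemma children_of_eq:
  "children_of T p = (if is_node T p then (\<lambda>i. p @ [i]) ` {..<length (children (subtree T p))} else {})"
  by (auto simp: children_of_def nodes_def is_node_snoc)

lemma eq_Leaf_iff: "T = Node [] \<longleftrightarrow> children T = []"
  by (cases T) auto

lemma mem_leaves_iff: "p \<in> leaves T \<longleftrightarrow> is_node T p \<and> subtree T p = Node []"
  by (auto simp: leaves_def nodes_def children_of_eq eq_Leaf_iff)

text \<open>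
  Conditions on a leaf are stated for a list of siblings and a position in it. The address of a node other
  than the root is written as \<open>p @ [i]\<close>, and \<open>children (subtree T p)\<close> is then the list of
  siblings that it belongs to.
\<close>

definition leaf_at :: "plane_tree list \<Rightarrow> nat \<Rightarrow> bool" where
  "leaf_at ts i \<longleftrightarrow> i < length ts \<and> ts ! i = Node []"

definition local_sites :: "(plane_tree list \<Rightarrow> nat \<Rightarrow> bool) \<Rightarrow> plane_tree \<Rightarrow> (nat list \<times> nat) set" where
  "local_sites R T = {(p, i). is_node T p \<and> i < length (children (subtree T p))
                              \<and> R (children (subtree T p)) i}"

lemma local_sites_Node:
  "local_sites R (Node ts) =
     Pair [] ` {i. i < length ts \<and> R ts i} \<union>
     (\<Union>j<length ts. (\<lambda>(p, i). (j # p, i)) ` local_sites R (ts ! j))" (is "?L = ?A \<union> ?B")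
proof (rule set_eqI)
  fix x :: "nat list \<times> nat"
  obtain p i where x: "x = (p, i)" by (cases x)
  show "x \<in> ?L \<longleftrightarrow> x \<in> ?A \<union> ?B"
    unfolding x by (cases p) (auto simp: local_sites_def image_iff)
qed

lemma finite_local_sites: "finite (local_sites R T)"
  by (induction T) (auto simp: local_sites_Node)

definition local_count :: "(plane_tree list \<Rightarrow> nat \<Rightarrow> bool) \<Rightarrow> plane_tree \<Rightarrow> nat" where
  "local_count R T = card (local_sites R T)"

text \<open>
  The parent \<open>p\<close> of a counted node is either the root, or it lies in the subtree
  \<open>ts ! j\<close>, where \<open>j\<close> is the first entry of \<open>p\<close>. These cases are disjoint, and removing
  \<open>j\<close> from the address changes neither the sibling list nor the position in it.
\<close>

lemma local_count_Node:
  "local_count R (Node ts) =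
     card {i. i < length ts \<and> R ts i} + sum_list (map (local_count R) ts)"
proof -
  have "card (\<Union>j<length ts. (\<lambda>(p, i). (j # p, i)) ` local_sites R (ts ! j))
      = (\<Sum>j<length ts. card ((\<lambda>(p, i). (j # p, i)) ` local_sites R (ts ! j)))"
    by (rule card_UN_disjoint) (auto simp: finite_local_sites)
  also have "\<dots> = (\<Sum>j<length ts. local_count R (ts ! j))"
    unfolding local_count_def by (intro sum.cong refl card_image) (auto simp: inj_on_def)
  also have "\<dots> = sum_list (map (local_count R) ts)"
    by (simp add: sum_list_sum_nth atLeast0LessThan)
  moreover have "card (Pair ([]::nat list) ` {i. i < length ts \<and> R ts i}) = card {i. i < length ts \<and> R ts i}"
    by (intro card_image) (auto simp: inj_on_def)
  ultimately show ?thesis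
    unfolding local_count_def local_sites_Node
    by (subst card_Un_disjoint) (auto simp: finite_local_sites)
qed

lemma card_eq_local_count:
  assumes "\<And>p. p \<in> X \<Longrightarrow> p \<noteq> []"
    and "\<And>p i. p @ [i] \<in> X \<longleftrightarrow> (p, i) \<in> local_sites R T"
  shows "card X = local_count R T"
proof -
  have "X = (\<lambda>(p, i). p @ [i]) ` local_sites R T"
  proof (intro set_eqI iffI)
    fix q assume q: "q \<in> X"
    then obtain p i where "q = p @ [i]" using assms(1) by (metis rev_exhaust)
    then show "q \<in> (\<lambda>(p, i). p @ [i]) ` local_sites R T" using q assms(2) by force
  qed (use assms(2) in auto)
  moreover have "inj_on (\<lambda>(p, i). p @ [i]) (local_sites R T)" by (auto simp: inj_on_def)
  ultimately show ?thesis by (simp add: card_image local_count_def)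
qed

text \<open>An edge is determined by its upper end and a child index there.\<close>

definition edges :: "plane_tree \<Rightarrow> nat" where
  "edges = local_count (\<lambda>_ _. True)"

text \<open>
  Positions start at 0, so the second child has position 1. An old leaf occupies position 0, and it
  is an elder leaf iff the length of its sibling list is not 1. A leaf in any other position is
  young.
\<close>

definition singleton_site :: "plane_tree list \<Rightarrow> nat \<Rightarrow> bool" where
  "singleton_site ts i \<longleftrightarrow> i = 0 \<and> leaf_at ts 0 \<and> length ts = 1"

definition elder_twin_site :: "plane_tree list \<Rightarrow> nat \<Rightarrow> bool" where
  "elder_twin_site ts i \<longleftrightarrow> i = 0 \<and> leaf_at ts 0 \<and> length ts \<noteq> 1 \<and> leaf_at ts 1"

definition elder_nontwin_site :: "plane_tree list \<Rightarrow> nat \<Rightarrow> bool" where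
  "elder_nontwin_site ts i \<longleftrightarrow> i = 0 \<and> leaf_at ts 0 \<and> length ts \<noteq> 1 \<and> \<not> leaf_at ts 1"

definition second_site :: "plane_tree list \<Rightarrow> nat \<Rightarrow> bool" where
  "second_site ts i \<longleftrightarrow> i = 1 \<and> leaf_at ts 1"

definition later_site :: "plane_tree list \<Rightarrow> nat \<Rightarrow> bool" where
  "later_site ts i \<longleftrightarrow> i \<ge> 2 \<and> leaf_at ts i"

lemma card_tree_edges: "card (tree_edges T) = edges T"
proof -
  have "tree_edges T = (\<lambda>(p, i). (p, p @ [i])) ` local_sites (\<lambda>_ _. True) T"
    by (auto simp: tree_edges_def nodes_def local_sites_def is_node_snoc)
  moreover have "inj_on (\<lambda>(p, i). (p, p @ [i])) (local_sites (\<lambda>_ _. True) T)"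
    by (auto simp: inj_on_def)
  ultimately show ?thesis by (simp add: card_image edges_def local_count_def)
qed

lemma only_child_iff:
  assumes "is_node T p"
  shows "children_of T p = {p @ [0]} \<longleftrightarrow> length (children (subtree T p)) = 1"
proof -
  let ?n = "length (children (subtree T p))"
  have C: "children_of T p = (\<lambda>i. p @ [i]) ` {..<?n}"
    using assms by (simp add: children_of_eq)
  show ?thesis
  proof
    assume "children_of T p = {p @ [0]}"
    then have "card ((\<lambda>i. p @ [i]) ` {..<?n}) = 1" using C by simp
    then show "?n = 1" by (simp add: card_image inj_on_def)
  next
    assume "?n = 1"
    then show "children_of T p = {p @ [0]}" using C by (simp add: lessThan_Suc)
  qed
qed

lemma snoc_mem_leaves: "p @ [i] \<in> leaves T \<longleftrightarrow> is_node T p \<and> leaf_at (children (subtree T p)) i"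
  by (auto simp: mem_leaves_iff is_node_snoc subtree_snoc leaf_at_def)

lemma snoc_mem_old_leaves:
  "p @ [i] \<in> old_leaves T \<longleftrightarrow> is_node T p \<and> i = 0 \<and> leaf_at (children (subtree T p)) 0"
  unfolding old_leaves_def by (cases "i = 0") (simp_all add: snoc_mem_leaves)

lemma mem_local_sites:
  "(p, i) \<in> local_sites R T \<longleftrightarrow>
     is_node T p \<and> i < length (children (subtree T p)) \<and> R (children (subtree T p)) i"
  by (simp add: local_sites_def)

lemma old_leaf_neq_root: "p \<in> old_leaves T \<Longrightarrow> p \<noteq> []"
  by (auto simp: old_leaves_def)

lemma leaf_at_length: "leaf_at ts i \<Longrightarrow> i < length ts"
  by (simp add: leaf_at_def)

lemma sleaf_eq: "sleaf T = local_count singleton_site T"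
  unfolding sleaf_def
proof (rule card_eq_local_count)
  fix p assume "p \<in> singleton_leaves T"
  then show "p \<noteq> []" by (auto simp: singleton_leaves_def dest: old_leaf_neq_root)
next
  fix p i
  show "p @ [i] \<in> singleton_leaves T \<longleftrightarrow> (p, i) \<in> local_sites singleton_site T"
    by (cases "is_node T p \<and> i = 0 \<and> leaf_at (children (subtree T p)) 0")
       (use leaf_at_length[of "children (subtree T p)" 0] in
        \<open>auto simp: singleton_leaves_def snoc_mem_old_leaves mem_local_sites singleton_site_def only_child_iff\<close>)
qed

lemma snoc_mem_elder_leaves:
  "p @ [i] \<in> elder_leaves T \<longleftrightarrow> is_node T p \<and> i = 0 \<and> leaf_at (children (subtree T p)) 0
     \<and> length (children (subtree T p)) \<noteq> 1"
  by (cases "is_node T p \<and> i = 0 \<and> leaf_at (children (subtree T p)) 0")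
     (auto simp: elder_leaves_def snoc_mem_old_leaves only_child_iff)

lemma etleaf_eq: "etleaf T = local_count elder_twin_site T"
  unfolding etleaf_def
proof (rule card_eq_local_count)
  fix p assume "p \<in> {p \<in> elder_leaves T. butlast p @ [1] \<in> leaves T}"
  then show "p \<noteq> []" by (auto simp: elder_leaves_def dest: old_leaf_neq_root)
next
  fix p i
  show "p @ [i] \<in> {p \<in> elder_leaves T. butlast p @ [1] \<in> leaves T}
      \<longleftrightarrow> (p, i) \<in> local_sites elder_twin_site T"
    using leaf_at_length[of "children (subtree T p)" 0]
    by (auto simp only: mem_Collect_eq butlast_snoc snoc_mem_elder_leaves snoc_mem_leaves
        mem_local_sites elder_twin_site_def)
qed

lemma entleaf_eq: "entleaf T = local_count elder_nontwin_site T"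
  unfolding entleaf_def
proof (rule card_eq_local_count)
  fix p assume "p \<in> {p \<in> elder_leaves T. butlast p @ [1] \<notin> leaves T}"
  then show "p \<noteq> []" by (auto simp: elder_leaves_def dest: old_leaf_neq_root)
next
  fix p i
  show "p @ [i] \<in> {p \<in> elder_leaves T. butlast p @ [1] \<notin> leaves T}
      \<longleftrightarrow> (p, i) \<in> local_sites elder_nontwin_site T"
    using leaf_at_length[of "children (subtree T p)" 0]
    by (auto simp only: mem_Collect_eq butlast_snoc snoc_mem_elder_leaves snoc_mem_leaves
        mem_local_sites elder_nontwin_site_def)
qed

lemma snoc_mem_young_leaves:
  "p @ [i] \<in> young_leaves T \<longleftrightarrow> is_node T p \<and> i \<noteq> 0 \<and> leaf_at (children (subtree T p)) i"
  by (cases "i = 0") (simp_all add: young_leaves_def snoc_mem_leaves snoc_mem_old_leaves)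

lemma syleaf_eq: "syleaf T = local_count second_site T"
  unfolding syleaf_def
proof (rule card_eq_local_count)
  fix p i
  show "p @ [i] \<in> {p \<in> young_leaves T. \<exists>q. p = q @ [1]} \<longleftrightarrow> (p, i) \<in> local_sites second_site T"
    using leaf_at_length[of "children (subtree T p)" i]
    by (cases "i = 1") (simp_all add: snoc_mem_young_leaves mem_local_sites second_site_def, blast)
qed auto

text \<open>The one-node tree is excluded: its root is a young leaf without a parent, so it sits in no list
  of siblings.\<close>

lemma yerleaf_eq:
  assumes "T \<noteq> Node []"
  shows "yerleaf T = local_count later_site T"
  unfolding yerleaf_def
proof (rule card_eq_local_count)
  fix p assume "p \<in> {p \<in> young_leaves T. \<not> (\<exists>q. p = q @ [1])}"
  then show "p \<noteq> []" using assms by (auto simp: young_leaves_def mem_leaves_iff)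
next
  fix p and i :: nat
  have "i \<noteq> 0 \<and> i \<noteq> 1 \<longleftrightarrow> i \<ge> 2" by linarith
  then show "p @ [i] \<in> {p \<in> young_leaves T. \<not> (\<exists>q. p = q @ [1])}
      \<longleftrightarrow> (p, i) \<in> local_sites later_site T"
    using leaf_at_length[of "children (subtree T p)" i]
    by (simp add: snoc_mem_young_leaves mem_local_sites later_site_def) blast
qed

section \<open>Weights of plane trees\<close>

abbreviation forest_size :: "plane_tree list \<Rightarrow> nat" where
  "forest_size ts \<equiv> sum_list (map (\<lambda>T. Suc (edges T)) ts)"

lemma edges_Node: "edges (Node ts) = forest_size ts"
proof -
  have "length ts + sum_list (map edges ts) = forest_size ts"
    by (induction ts) auto
  then show ?thesis by (simp add: edges_def local_count_Node)
qed

lemma card_later_sites: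
  "card {i. i < length (T1 # T2 # ts) \<and> later_site (T1 # T2 # ts) i}
     = length (filter (\<lambda>T. T = Node []) ts)"
proof -
  have "{i. i < length (T1 # T2 # ts) \<and> later_site (T1 # T2 # ts) i}
      = (\<lambda>i. i + 2) ` {i. i < length ts \<and> ts ! i = Node []}"
  proof -
    have "i \<in> (\<lambda>i. i + 2) ` {i. i < length ts \<and> ts ! i = Node []}"
      if "i \<ge> 2" "i < length ts + 2" "(T1 # T2 # ts) ! i = Node []" for i
    proof -
      define j where "j = i - 2"
      then have "i = j + 2" using that(1) by simp
      then show ?thesis using that by auto
    qed
    then show ?thesis by (auto simp: later_site_def leaf_at_def)
  qed
  then show ?thesis by (simp add: card_image inj_on_def length_filter_conv_card)
qed

context
  fixes u1 u2 u3 v1 v2 :: "'a :: comm_semiring_1"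
begin

definition weight :: "plane_tree \<Rightarrow> 'a" where
  "weight T = u1 ^ local_count singleton_site T * u2 ^ local_count elder_twin_site T
     * u3 ^ local_count elder_nontwin_site T
     * v1 ^ local_count later_site T * v2 ^ local_count second_site T"

text \<open>
  The weight of a subtree inside a larger tree: a leaf has no weight by itself, its contribution
  \<open>x\<close> is determined by its position among the children of its parent. Any other subtree keeps
  its weight, and \<open>y\<close> is the factor of an elder leaf in front of it, if there is one.
\<close>

definition slot :: "'a \<Rightarrow> 'a \<Rightarrow> plane_tree \<Rightarrow> 'a" where
  "slot x y T = (if T = Node [] then x else y * weight T)"

lemma weight_Node:
  "weight (Node ts) =
     u1 ^ card {i. i < length ts \<and> singleton_site ts i}
     * u2 ^ card {i. i < length ts \<and> elder_twin_site ts i}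
     * u3 ^ card {i. i < length ts \<and> elder_nontwin_site ts i}
     * v1 ^ card {i. i < length ts \<and> later_site ts i}
     * v2 ^ card {i. i < length ts \<and> second_site ts i}
     * prod_list (map weight ts)"
proof -
  have "prod_list (map weight ts) =
     u1 ^ sum_list (map (local_count singleton_site) ts)
     * u2 ^ sum_list (map (local_count elder_twin_site) ts)
     * u3 ^ sum_list (map (local_count elder_nontwin_site) ts)
     * v1 ^ sum_list (map (local_count later_site) ts)
     * v2 ^ sum_list (map (local_count second_site) ts)"
    by (induction ts) (simp_all add: weight_def power_add mult_ac)
  then show ?thesis
    by (simp add: weight_def local_count_Node power_add mult_ac)
qed

lemma weight_Leaf: "weight (Node []) = 1"
  by (simp add: weight_Node)

lemma weight_single: "weight (Node [T]) = slot u1 1 T"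
proof -
  have sites:
    "{i. i < length [T] \<and> singleton_site [T] i} = (if T = Node [] then {0} else {})"
    "{i. i < length [T] \<and> elder_twin_site [T] i} = {}"
    "{i. i < length [T] \<and> elder_nontwin_site [T] i} = {}"
    "{i. i < length [T] \<and> later_site [T] i} = {}"
    "{i. i < length [T] \<and> second_site [T] i} = {}"
    by (auto simp: singleton_site_def elder_twin_site_def elder_nontwin_site_def later_site_def
        second_site_def leaf_at_def)
  show ?thesis
    unfolding weight_Node sites by (cases "T = Node []") (simp_all add: slot_def weight_Leaf)
qed

lemma prod_list_slot:
  "prod_list (map (slot v1 1) ts) =
     v1 ^ length (filter (\<lambda>T. T = Node []) ts) * prod_list (map weight ts)"
  by (induction ts) (auto simp: slot_def weight_Leaf mult_ac)

text \<open>
  If the first child is a leaf, then the second child decides between the elder leaf statistics, so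
  the factor of the elder leaf is charged to the second child: \<open>u2 * v2\<close> if that child is a
  leaf itself, and \<open>u3\<close> otherwise.
\<close>

lemma weight_two:
  "weight (Node (T1 # T2 # ts)) =
     (if T1 = Node [] then slot (u2 * v2) u3 T2 else weight T1 * slot v2 1 T2)
     * prod_list (map (slot v1 1) ts)"
proof -
  let ?l = "T1 # T2 # ts"
  have sites: "{i. i < length ?l \<and> singleton_site ?l i} = {}"
    "{i. i < length ?l \<and> elder_twin_site ?l i}
        = (if T1 = Node [] \<and> T2 = Node [] then {0} else {})"
    "{i. i < length ?l \<and> elder_nontwin_site ?l i}
        = (if T1 = Node [] \<and> T2 \<noteq> Node [] then {0} else {})"
    "{i. i < length ?l \<and> second_site ?l i} = (if T2 = Node [] then {1} else {})"
    by (auto simp: singleton_site_def elder_twin_site_def elder_nontwin_site_def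
        second_site_def leaf_at_def)
  show ?thesis
    unfolding weight_Node card_later_sites prod_list_slot sites
    by (cases "T1 = Node []"; cases "T2 = Node []") (simp_all add: slot_def weight_Leaf mult_ac)
qed

end

section \<open>Generating functions of weighted sets\<close>

text \<open>
  The generating function of a set of objects by size sums over each fibre of the size function. If
  a fibre is infinite, this sum is 0 by convention, so the rules for disjoint unions and for
  products need finite fibres.
\<close>

definition finite_fibres :: "('b \<Rightarrow> nat) \<Rightarrow> 'b set \<Rightarrow> bool" where
  "finite_fibres sz A \<longleftrightarrow> (\<forall>n. finite {x \<in> A. sz x = n})"

definition gf :: "('b \<Rightarrow> nat) \<Rightarrow> ('b \<Rightarrow> 'a :: comm_semiring_1) \<Rightarrow> 'b set \<Rightarrow> 'a fps" where
  "gf sz wt A = Abs_fps (\<lambda>n. \<Sum>x | x \<in> A \<and> sz x = n. wt x)"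

lemma finite_fibres_subset: "finite_fibres sz B \<Longrightarrow> A \<subseteq> B \<Longrightarrow> finite_fibres sz A"
  unfolding finite_fibres_def by (auto intro: finite_subset[of _ "{x \<in> B. sz x = _}"])

lemma finite_fibres_Suc: "finite_fibres sz A \<Longrightarrow> finite_fibres (\<lambda>x. Suc (sz x)) A"
  unfolding finite_fibres_def
proof
  fix n assume "\<forall>n. finite {x \<in> A. sz x = n}"
  then show "finite {x \<in> A. Suc (sz x) = n}" by (cases n) auto
qed

lemma gf_Un:
  assumes "finite_fibres sz (A \<union> B)" "A \<inter> B = {}"
  shows "gf sz wt (A \<union> B) = gf sz wt A + gf sz wt B"
proof -
  have "(\<Sum>x | x \<in> A \<union> B \<and> sz x = n. wt x) =
      (\<Sum>x | x \<in> A \<and> sz x = n. wt x) + (\<Sum>x | x \<in> B \<and> sz x = n. wt x)" for n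
  proof -
    have "{x. x \<in> A \<union> B \<and> sz x = n} = {x. x \<in> A \<and> sz x = n} \<union> {x. x \<in> B \<and> sz x = n}" by auto
    moreover have "finite {x. x \<in> A \<union> B \<and> sz x = n}"
      using assms(1) by (simp add: finite_fibres_def)
    ultimately show ?thesis
      using assms(2) by (auto intro!: sum.union_disjoint)
  qed
  then show ?thesis by (simp add: gf_def fps_eq_iff)
qed

lemma gf_image:
  assumes "inj_on f A"
    and "\<And>x. x \<in> A \<Longrightarrow> sz (f x) = sz' x + k"
    and "\<And>x. x \<in> A \<Longrightarrow> wt (f x) = c * wt' x"
  shows "gf sz wt (f ` A) = fps_const c * fps_X ^ k * gf sz' wt' A"
proof (rule fps_ext)
  fix n
  have *: "{x. x \<in> f ` A \<and> sz x = n} = f ` {x \<in> A. sz' x + k = n}" using assms(2) by auto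
  have "fps_nth (gf sz wt (f ` A)) n = (\<Sum>x\<in>{x \<in> A. sz' x + k = n}. wt (f x))"
    unfolding gf_def fps_nth_Abs_fps *
    by (rule sum.reindex[unfolded o_def]) (use assms(1) in \<open>auto simp: inj_on_def\<close>)
  also have "\<dots> = (\<Sum>x\<in>{x \<in> A. sz' x + k = n}. c * wt' x)"
    by (rule sum.cong) (auto simp: assms(3))
  also have "\<dots> = c * (if n < k then 0 else fps_nth (gf sz' wt' A) (n - k))"
  proof (cases "n < k")
    case True
    then have "{x \<in> A. sz' x + k = n} = {}" by auto
    then show ?thesis using True by simp
  next
    case False
    then have "{x \<in> A. sz' x + k = n} = {x \<in> A. sz' x = n - k}" by auto
    then show ?thesis using False by (simp add: gf_def sum_distrib_left)
  qed
  also have "\<dots> = fps_nth (fps_const c * fps_X ^ k * gf sz' wt' A) n"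
    by (simp add: mult.assoc fps_X_power_mult_nth)
  finally show "fps_nth (gf sz wt (f ` A)) n = fps_nth (fps_const c * fps_X ^ k * gf sz' wt' A) n" .
qed

lemma prod_fibre:
  "{x. x \<in> A \<times> B \<and> (case x of (a, b) \<Rightarrow> sA a + sB b) = n}
     = (\<Union>i\<in>{0..n}. {a \<in> A. sA a = i} \<times> {b \<in> B. sB b = (n :: nat) - i})"
  by auto

lemma finite_fibres_prod:
  assumes "finite_fibres sA A" "finite_fibres sB B"
  shows "finite_fibres (\<lambda>(a, b). sA a + sB b) (A \<times> B)"
  using assms unfolding finite_fibres_def prod_fibre by auto

lemma gf_prod:
  assumes "finite_fibres sA A" "finite_fibres sB B"
  shows "gf (\<lambda>(a, b). sA a + sB b) (\<lambda>(a, b). wA a * wB b) (A \<times> B) = gf sA wA A * gf sB wB B"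
proof (rule fps_ext)
  fix n
  let ?A = "\<lambda>i. {a \<in> A. sA a = i}" and ?B = "\<lambda>i. {b \<in> B. sB b = i}"
  have fin: "finite (?A i)" "finite (?B i)" for i using assms by (auto simp: finite_fibres_def)
  have "fps_nth (gf (\<lambda>(a, b). sA a + sB b) (\<lambda>(a, b). wA a * wB b) (A \<times> B)) n
      = (\<Sum>x\<in>(\<Union>i\<in>{0..n}. ?A i \<times> ?B (n - i)). case x of (a, b) \<Rightarrow> wA a * wB b)"
    unfolding gf_def fps_nth_Abs_fps prod_fibre ..
  also have "\<dots> = (\<Sum>i=0..n. \<Sum>x\<in>?A i \<times> ?B (n - i). case x of (a, b) \<Rightarrow> wA a * wB b)"
    by (rule sum.UNION_disjoint) (use fin in auto)
  also have "\<dots> = (\<Sum>i=0..n. (\<Sum>a\<in>?A i. wA a) * (\<Sum>b\<in>?B (n - i). wB b))"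
    by (simp add: sum_product sum.cartesian_product)
  finally show "fps_nth (gf (\<lambda>(a, b). sA a + sB b) (\<lambda>(a, b). wA a * wB b) (A \<times> B)) n
      = fps_nth (gf sA wA A * gf sB wB B) n"
    by (simp add: fps_mult_nth gf_def)
qed

lemma gf_singleton: "gf sz wt {x} = fps_const (wt x) * fps_X ^ sz x"
proof (rule fps_ext)
  fix n
  have "{y. y = x \<and> sz y = n} = (if n = sz x then {x} else {})" by auto
  then show "fps_nth (gf sz wt {x}) n = fps_nth (fps_const (wt x) * fps_X ^ sz x) n"
    by (simp add: gf_def fps_X_power_nth)
qed

section \<open>The functional equation\<close>

text \<open>
  There are finitely many forests of a given size: a nonempty list \<open>Node us # ts\<close> is determined
  by \<open>us\<close> and \<open>ts\<close>, both of which have smaller size, because every tree in a forest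
  contributes at least 1 (the edge to its parent).
\<close>

lemma finite_fibres_forests: "finite_fibres forest_size UNIV"
proof -
  have "finite {ts. forest_size ts = n}" for n
  proof (induction n rule: less_induct)
    case (less n)
    let ?F = "\<Union>k<n. {ts. forest_size ts = k}"
    have "{ts. forest_size ts = n} \<subseteq> insert [] ((\<lambda>(us, ts). Node us # ts) ` (?F \<times> ?F))"
    proof
      fix ts assume ts: "ts \<in> {ts. forest_size ts = n}"
      show "ts \<in> insert [] ((\<lambda>(us, ts). Node us # ts) ` (?F \<times> ?F))"
      proof (cases ts)
        case (Cons T us)
        obtain vs where "T = Node vs" by (cases T)
        then show ?thesis using ts Cons by (force simp: edges_Node)
      qed simp
    qed
    moreover have "finite (insert [] ((\<lambda>(us, ts). Node us # ts) ` (?F \<times> ?F)))"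
      using less by auto
    ultimately show ?case by (rule finite_subset)
  qed
  then show ?thesis by (simp add: finite_fibres_def)
qed

lemma finite_fibres_trees: "finite_fibres edges UNIV"
proof -
  have "{T. edges T = n} = Node ` {ts. forest_size ts = n}" for n
  proof -
    have "T \<in> Node ` {ts. forest_size ts = n}" if "edges T = n" for T
      using that by (cases T) (auto simp: edges_Node)
    then show ?thesis by (auto simp: edges_Node)
  qed
  then show ?thesis using finite_fibres_forests by (simp add: finite_fibres_def)
qed

text \<open>
  Excluding the one-node tree gives the constant term 0. The coefficient of degree 1, which is
  prescribed as \<open>u1\<close>, agrees with the general formula, because the only tree with one edge
  has a single leaf, which is a singleton leaf.
\<close>

lemma N_series_eq_gf:
  "N_series u1 u2 u3 v1 v2 = gf edges (weight u1 u2 u3 v1 v2) (- {Node []})"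
proof (rule fps_ext)
  fix n :: nat
  let ?w = "weight u1 u2 u3 v1 v2"
  have edges0: "edges T = 0 \<longleftrightarrow> T = Node []" for T
    by (cases T; cases "children T") (auto simp: edges_Node)
  consider "n = 0" | "n = 1" | "n \<ge> 2" by linarith
  then show "fps_nth (N_series u1 u2 u3 v1 v2) n = fps_nth (gf edges ?w (- {Node []})) n"
  proof cases
    case 1
    then have fibre: "{T. T \<in> - {Node []} \<and> edges T = n} = {}" by (auto simp: edges0)
    show ?thesis unfolding gf_def fps_nth_Abs_fps fibre using 1 by (simp add: N_series_def)
  next
    case 2
    have "edges T = 1 \<longleftrightarrow> T = Node [Node []]" for T
    proof -
      obtain ts where T: "T = Node ts" by (cases T)
      show ?thesis unfolding T
        by (cases ts rule: remdups_adj.cases) (auto simp: edges_Node edges0)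
    qed
    then have fibre: "{T. T \<in> - {Node []} \<and> edges T = n} = {Node [Node []]}"
      using 2 by auto
    show ?thesis unfolding gf_def fps_nth_Abs_fps fibre using 2
      by (simp add: N_series_def N_coeff_def weight_single slot_def)
  next
    case 3
    then have fibre: "{T. T \<in> - {Node []} \<and> edges T = n} = plane_trees n"
      by (auto simp: plane_trees_def card_tree_edges edges_Node)
    have "?w T = u1 ^ sleaf T * u2 ^ etleaf T * u3 ^ entleaf T * v1 ^ yerleaf T * v2 ^ syleaf T"
      if "T \<in> plane_trees n" for T
    proof -
      have "T \<noteq> Node []" using that 3 by (auto simp: plane_trees_def card_tree_edges edges_Node)
      then show ?thesis
        by (simp add: weight_def sleaf_eq etleaf_eq entleaf_eq syleaf_eq yerleaf_eq)
    qed
    then show ?thesis unfolding gf_def fps_nth_Abs_fps fibre using 3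
      by (simp add: N_series_def N_coeff_def)
  qed
qed

context
  fixes u1 u2 u3 v1 v2 :: "'a :: comm_semiring_1"
begin

private abbreviation (input) "w \<equiv> weight u1 u2 u3 v1 v2"
private abbreviation (input) "sl \<equiv> slot u1 u2 u3 v1 v2"
private abbreviation (input) "N \<equiv> N_series u1 u2 u3 v1 v2"
private abbreviation (input) "S \<equiv> gf forest_size (\<lambda>ts. prod_list (map (sl v1 1) ts)) UNIV"

text \<open>The factor \<open>fps_X\<close> stands for the edge from the subtree to its parent.\<close>

lemma gf_slot:
  "gf (\<lambda>T. Suc (edges T)) (sl x y) UNIV = fps_X * (fps_const x + fps_const y * N)"
proof -
  let ?sz = "\<lambda>T. Suc (edges T)"
  have "gf ?sz (sl x y) UNIV = gf ?sz (sl x y) ({Node []} \<union> - {Node []})"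
    by simp
  also have "\<dots> = gf ?sz (sl x y) {Node []} + gf ?sz (sl x y) (- {Node []})"
    using finite_fibres_Suc[OF finite_fibres_trees] by (intro gf_Un) auto
  also have "gf ?sz (sl x y) {Node []} = fps_X * fps_const x"
    by (simp add: gf_singleton slot_def edges_Node mult.commute)
  also have "gf ?sz (sl x y) (- {Node []}) = fps_X * (fps_const y * N)"
    \<comment> \<open>The identity map is used to change the size function.\<close>
    using gf_image[of id "- {Node []}" ?sz edges 1 "sl x y" y w]
    by (simp add: slot_def N_series_eq_gf mult_ac)
  finally show ?thesis by (simp add: distrib_left)
qed

text \<open>
  A list is empty or a first tree followed by a list, and the weight of a list of trees in third or
  later position is multiplicative along this decomposition.
\<close>

lemma forest_equation: "S = 1 + fps_X * (fps_const v1 + N) * S"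
proof -
  let ?wt = "\<lambda>ts. prod_list (map (sl v1 1) ts)"
  let ?sz = "\<lambda>T. Suc (edges T)"
  let ?C = "(\<lambda>(T, ts). T # ts) ` (UNIV :: (plane_tree \<times> plane_tree list) set)"
  have split: "UNIV = {[]} \<union> ?C"
  proof -
    have "ts \<in> {[]} \<union> ?C" for ts by (cases ts) auto
    then show ?thesis by blast
  qed
  have "S = gf forest_size ?wt {[]} + gf forest_size ?wt ?C"
    by (subst split, rule gf_Un) (use finite_fibres_forests split in auto)
  also have "gf forest_size ?wt {[]} = 1"
    by (simp add: gf_singleton)
  also have "gf forest_size ?wt ?C
      = gf (\<lambda>(T, ts). ?sz T + forest_size ts) (\<lambda>(T, ts). sl v1 1 T * ?wt ts) (UNIV \<times> UNIV)"
    using gf_image[of "\<lambda>(T, ts). T # ts" UNIV forest_size "\<lambda>(T, ts). ?sz T + forest_size ts" 0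
        ?wt 1 "\<lambda>(T, ts). sl v1 1 T * ?wt ts"]
    by (simp add: inj_on_def split_beta prod_eq_iff)
  also have "\<dots> = gf ?sz (sl v1 1) UNIV * S"
    by (intro gf_prod finite_fibres_Suc finite_fibres_trees finite_fibres_forests)
  finally show ?thesis unfolding gf_slot fps_const_1_eq_1 mult_1_left .
qed

text \<open>
  The first summand belongs to the roots with a single child. In the second, \<open>u2 * v2\<close> and
  \<open>u3 * N\<close> belong to a first child that is an elder leaf, \<open>v2 * N\<close> and \<open>N ^ 2\<close> to a
  first child that is not a leaf; \<open>fps_X ^ 2\<close> stands for the edges to the first two children.
\<close>

lemma tree_equation:
  "N = fps_X * (fps_const u1 + N)
       + fps_X ^ 2 * (fps_const (u2 * v2) + fps_const u3 * N + fps_const v2 * N + N ^ 2) * S"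
proof -
  let ?wt = "\<lambda>ts. prod_list (map (sl v1 1) ts)"
  let ?sz = "\<lambda>T. Suc (edges T)"
  \<comment> \<open>A first child that is a leaf and has siblings contributes only its edge to the size: its factor
    is charged to the second child. Therefore the trees with at least two children are split
    according to whether the first child is a leaf.\<close>
  define A where "A = range (\<lambda>T. Node [T])"
  define B where "B = (\<lambda>(T, ts). Node (Node [] # T # ts)) ` (UNIV \<times> UNIV)"
  define C where "C = (\<lambda>(T1, T2, ts). Node (T1 # T2 # ts)) ` ((- {Node []}) \<times> UNIV \<times> UNIV)"
  have split: "- {Node []} = A \<union> (B \<union> C)"
  proof -
    have "Node ts \<in> A \<union> (B \<union> C)" if "ts \<noteq> []" for ts
      \<comment> \<open>\<open>remdups_adj.cases\<close> distinguishes lists of length 0, 1 and at least 2.\<close>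
    proof (cases ts rule: remdups_adj.cases)
      case (3 T1 T2 us)
      then show ?thesis by (cases "T1 = Node []") (auto simp: B_def C_def image_iff)
    qed (use that in \<open>auto simp: A_def\<close>)
    then have "T \<in> A \<union> (B \<union> C)" if "T \<noteq> Node []" for T using that by (cases T) auto
    then show ?thesis by (auto simp: A_def B_def C_def)
  qed
  have "N = gf edges w A + (gf edges w B + gf edges w C)"
  proof -
    have fin: "finite_fibres edges X" for X
      using finite_fibres_subset[OF finite_fibres_trees] by blast
    have "A \<inter> (B \<union> C) = {}" "B \<inter> C = {}" by (auto simp: A_def B_def C_def)
    then show ?thesis unfolding N_series_eq_gf split by (simp add: gf_Un fin)
  qed
  also have "gf edges w A = gf ?sz (sl u1 1) UNIV"
    unfolding A_def
    using gf_image[of "\<lambda>T. Node [T]" UNIV edges ?sz 0 w 1 "sl u1 1"]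
    by (simp add: inj_on_def edges_Node weight_single)
  also have "gf edges w B = fps_X * (gf ?sz (sl (u2 * v2) u3) UNIV * S)"
  proof -
    have "gf edges w B = fps_X * gf (\<lambda>(T, ts). ?sz T + forest_size ts)
        (\<lambda>(T, ts). sl (u2 * v2) u3 T * ?wt ts) (UNIV \<times> UNIV)"
      unfolding B_def
      using gf_image[of "\<lambda>(T, ts). Node (Node [] # T # ts)" "UNIV \<times> UNIV" edges
          "\<lambda>(T, ts). ?sz T + forest_size ts" 1 w 1 "\<lambda>(T, ts). sl (u2 * v2) u3 T * ?wt ts"]
      by (simp add: inj_on_def split_beta edges_Node weight_two prod_eq_iff)
    also have "gf (\<lambda>(T, ts). ?sz T + forest_size ts)
        (\<lambda>(T, ts). sl (u2 * v2) u3 T * ?wt ts) (UNIV \<times> UNIV) = gf ?sz (sl (u2 * v2) u3) UNIV * S"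
      by (intro gf_prod finite_fibres_Suc finite_fibres_trees finite_fibres_forests)
    finally show ?thesis .
  qed
  also have "gf edges w C = fps_X * (N * (gf ?sz (sl v2 1) UNIV * S))"
  proof -
    let ?s = "\<lambda>(T, ts). ?sz T + forest_size ts" and ?p = "\<lambda>(T, ts). sl v2 1 T * ?wt ts"
    have "gf edges w C = fps_X * gf (\<lambda>(T, x). edges T + ?s x) (\<lambda>(T, x). w T * ?p x)
        ((- {Node []}) \<times> UNIV \<times> UNIV)"
      unfolding C_def
      using gf_image[of "\<lambda>(T1, T2, ts). Node (T1 # T2 # ts)" "(- {Node []}) \<times> UNIV \<times> UNIV"
          edges "\<lambda>(T, x). edges T + ?s x" 1 w 1 "\<lambda>(T, x). w T * ?p x"]
      by (simp add: inj_on_def split_beta edges_Node weight_two prod_eq_iff mem_Times_iff mult.assoc)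
    also have "gf (\<lambda>(T, x). edges T + ?s x) (\<lambda>(T, x). w T * ?p x) ((- {Node []}) \<times> UNIV \<times> UNIV)
        = N * gf ?s ?p (UNIV \<times> UNIV)"
      unfolding N_series_eq_gf
      by (intro gf_prod finite_fibres_prod finite_fibres_Suc finite_fibres_trees
          finite_fibres_forests finite_fibres_subset[OF finite_fibres_trees]) auto
    also have "gf ?s ?p (UNIV \<times> UNIV) = gf ?sz (sl v2 1) UNIV * S"
      by (intro gf_prod finite_fibres_Suc finite_fibres_trees finite_fibres_forests)
    finally show ?thesis .
  qed
  finally have "N = fps_X * (fps_const u1 + N)
      + (fps_X * (fps_X * (fps_const (u2 * v2) + fps_const u3 * N) * S)
      + fps_X * (N * (fps_X * (fps_const v2 + N) * S)))"
    unfolding gf_slot fps_const_1_eq_1 mult_1_left .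
  also have "\<dots> = fps_X * (fps_const u1 + N)
       + fps_X ^ 2 * (fps_const (u2 * v2) + fps_const u3 * N + fps_const v2 * N + N ^ 2) * S"
    by (simp only: algebra_simps power2_eq_square)
  finally show ?thesis .
qed

end

text \<open>
  The forest equation makes \<open>1 - fps_X * (fps_const v1 + N)\<close> the inverse of the forest series,
  so multiplying the tree equation by it leaves a polynomial equation in \<open>N\<close>.
\<close>

lemma N_series_quadratic:
  fixes u1 u2 u3 v1 v2 :: "'a :: comm_ring_1"
  defines "N \<equiv> N_series u1 u2 u3 v1 v2"
  shows "fps_X * N ^ 2
      - (fps_const (u1 - u3 + v1 - v2) * fps_X ^ 2 - fps_const (v1 + 1) * fps_X + 1) * N
      + fps_X * fps_const u1 - fps_X ^ 2 * fps_const (u1 * v1 - u2 * v2) = 0"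
proof -
  define S where "S = gf forest_size (\<lambda>ts. prod_list (map (slot u1 u2 u3 v1 v2 v1 1) ts)) UNIV"
  define Q where "Q = fps_const u2 * fps_const v2 + fps_const u3 * N + fps_const v2 * N + N ^ 2"
  define K where "K = 1 - fps_X * (fps_const v1 + N)"
  have S: "S = 1 + fps_X * (fps_const v1 + N) * S"
    unfolding S_def N_def by (rule forest_equation)
  have "S * K = S - fps_X * (fps_const v1 + N) * S"
    by (simp add: K_def algebra_simps)
  also have "\<dots> = 1"
    using S by (metis add_diff_cancel_right')
  finally have SK: "S * K = 1" .
  have "N = fps_X * (fps_const u1 + N) + fps_X ^ 2 * Q * S"
    unfolding N_def S_def Q_def fps_const_mult by (rule tree_equation)
  then have "N * K = (fps_X * (fps_const u1 + N) + fps_X ^ 2 * Q * S) * K"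
    by (rule arg_cong[where f = "\<lambda>z. z * K"])
  also have "\<dots> = fps_X * (fps_const u1 + N) * K + fps_X ^ 2 * Q * (S * K)"
    by (simp only: distrib_right mult.assoc)
  finally have "N * K - fps_X * (fps_const u1 + N) * K - fps_X ^ 2 * Q = 0"
    by (simp only: SK) simp
  then show ?thesis
    unfolding K_def Q_def
    by (simp add: algebra_simps power2_eq_square
        flip: fps_const_add fps_const_sub fps_const_mult)
qed

section \<open>Solving the quadratic equation\<close>

lemma to_laurent_diff: "to_laurent (f - g) = to_laurent f - to_laurent g"
proof -
  have "Abs_fps (\<lambda>n. to_fract (fps_nth (f - g) n))
      = Abs_fps (\<lambda>n. to_fract (fps_nth f n)) - Abs_fps (\<lambda>n. to_fract (fps_nth g n))"
    by (simp add: fps_eq_iff)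
  then show ?thesis by (simp add: to_laurent_def)
qed

lemma to_laurent_mult: "to_laurent (f * g) = to_laurent f * to_laurent g"
proof -
  have "Abs_fps (\<lambda>n. to_fract (fps_nth (f * g) n))
      = Abs_fps (\<lambda>n. to_fract (fps_nth f n)) * Abs_fps (\<lambda>n. to_fract (fps_nth g n))"
    by (simp add: fps_eq_iff fps_mult_nth)
  then show ?thesis by (simp add: to_laurent_def fls_times_fps_to_fls)
qed

lemma to_laurent_eq_0_iff: "to_laurent f = 0 \<longleftrightarrow> f = 0"
  by (simp add: to_laurent_def fps_eq_iff)

lemma fps_sqrt_eqI:
  fixes f g :: "mpoly fps"
  assumes "fps_nth g 0 = 1" "g ^ 2 = f"
  shows "fps_sqrt f = g"
proof -
  have "fps_nth f 0 = 1" using assms by (auto simp: power2_eq_square)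
  from fps_sqrt_ex1[OF this] assms show ?thesis
    unfolding fps_sqrt_def by (intro the1_equality) auto
qed

text \<open>
  Completing the square: for a root \<open>N\<close> of \<open>X * N ^ 2 - P * N + r\<close> one has
  \<open>(P - 2 * X * N) ^ 2 = P ^ 2 - 4 * X * r\<close>. With \<open>2 * u1 = a + b\<close> and
  \<open>v1 = c - 1\<close>, the right-hand side takes the stated form in \<open>a\<close>, \<open>b\<close> and \<open>c\<close>.
\<close>

lemma discriminant_identity:
  fixes u1 u2 v1 v2 X N a b c :: "'a :: comm_ring_1"
  assumes "X * N ^ 2 - (a * X ^ 2 - c * X + 1) * N + X * u1 - X ^ 2 * (u1 * v1 - u2 * v2) = 0"
    and "b = 2 * u1 - a" "c = v1 + 1"
  shows "((a * X ^ 2 - c * X + 1) - 2 * X * N) ^ 2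
     = a ^ 2 * X ^ 4 + 2 * (b * c - 2 * u1 - 2 * u2 * v2) * X ^ 3 + (c ^ 2 - 2 * b) * X ^ 2
       - 2 * c * X + 1"
proof -
  define P where "P = a * X ^ 2 - c * X + 1"
  have "(P - 2 * X * N) ^ 2 =
     P ^ 2 - 4 * X * (X * u1 - X ^ 2 * (u1 * v1 - u2 * v2))
     + 4 * X * (X * N ^ 2 - P * N + X * u1 - X ^ 2 * (u1 * v1 - u2 * v2))"
    by (simp add: algebra_simps power2_eq_square power3_eq_cube)
  also have "\<dots> = P ^ 2 - 4 * X * (X * u1 - X ^ 2 * (u1 * v1 - u2 * v2))"
    using assms(1) by (simp add: P_def)
  also have "\<dots> = a ^ 2 * X ^ 4 + 2 * (b * c - 2 * u1 - 2 * u2 * v2) * X ^ 3 + (c ^ 2 - 2 * b) * X ^ 2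
       - 2 * c * X + 1"
    unfolding P_def assms(2,3) by (simp add: algebra_simps power2_eq_square power3_eq_cube power4_eq_xxxx)
  finally show ?thesis by (simp add: P_def)
qed

theorem theorem2p11:
  fixes u1 u2 u3 v1 v2 a b c :: mpoly and t :: "mpoly fps"
  defines "u1 \<equiv> indet 0" and "u2 \<equiv> indet 1" and "u3 \<equiv> indet 2"
    and "v1 \<equiv> indet 3" and "v2 \<equiv> indet 4"
    and "t \<equiv> fps_X"
    and "a \<equiv> u1 - u3 + v1 - v2"
    and "b \<equiv> u1 + u3 - v1 + v2"
    and "c \<equiv> v1 + 1"
  shows "to_laurent (N_series u1 u2 u3 v1 v2) =
    to_laurent (fps_const a * t ^ 2 - fps_const c * t + 1) / to_laurent (2 * t)
    - to_laurent (fps_sqrt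
        (fps_const (a ^ 2) * t ^ 4
         + fps_const (2 * (b * c - 2 * u1 - 2 * u2 * v2)) * t ^ 3
         + fps_const (c ^ 2 - 2 * b) * t ^ 2
         - fps_const (2 * c) * t + 1)) / to_laurent (2 * t)"
proof -
  define N where "N = N_series u1 u2 u3 v1 v2"
  define P where "P = fps_const a * t ^ 2 - fps_const c * t + 1"
  define D where "D = fps_const (a ^ 2) * t ^ 4
         + fps_const (2 * (b * c - 2 * u1 - 2 * u2 * v2)) * t ^ 3
         + fps_const (c ^ 2 - 2 * b) * t ^ 2
         - fps_const (2 * c) * t + 1"
  have "t * N ^ 2 - P * N + t * fps_const u1 - t ^ 2 * (fps_const u1 * fps_const v1 - fps_const u2 * fps_const v2) = 0"
    using N_series_quadratic[of u1 u2 u3 v1 v2]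
    by (simp add: N_def P_def a_def c_def t_def)
  then have "(P - 2 * t * N) ^ 2
     = fps_const a ^ 2 * t ^ 4
       + 2 * (fps_const b * fps_const c - 2 * fps_const u1 - 2 * fps_const u2 * fps_const v2) * t ^ 3
       + (fps_const c ^ 2 - 2 * fps_const b) * t ^ 2 - 2 * fps_const c * t + 1"
    unfolding P_def
    by (rule discriminant_identity)
       (simp_all add: a_def b_def c_def numeral_fps_const flip: fps_const_1_eq_1)
  also have "\<dots> = D"
    unfolding D_def
    by (simp add: numeral_fps_const fps_const_power)
  finally have "(P - 2 * t * N) ^ 2 = D" .
  moreover have "fps_nth (P - 2 * t * N) 0 = 1"
    by (simp add: P_def t_def mult.assoc)
  ultimately have "fps_sqrt D = P - 2 * t * N"
    by (intro fps_sqrt_eqI)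
  then have "to_laurent (fps_sqrt D) = to_laurent P - to_laurent (2 * t) * to_laurent N"
    by (simp add: to_laurent_diff to_laurent_mult)
  moreover have "to_laurent (2 * t) \<noteq> 0"
    by (simp add: to_laurent_eq_0_iff t_def)
  ultimately show ?thesis
    unfolding N_def P_def D_def by (simp add: field_simps)
qed

end
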